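(* There is a sequence $\vec{R} = \langle R_i : i \in \omega\rangle$ of subsets of $\omega$ such that for every natural number $m$ and every partition $A_0,\ldots,A_{m-1}$ of $\omega$ that is arithmetical in $\vec{R}$, there is some $j<m$ and an infinite set $S \subseteq A_j$ such that $S$ computes no $\vec{R}$-cohesive set.
   Context: For a sequence $\vec{R} = \langle R_i : i\in\omega \rangle$ of subsets of $\omega$, a set $S \subseteq \omega$ is called $\vec{R}$-cohesive if $S$ is infinite and for every $i$, either $S \cap R_i$ is finite or $S \cap \overline{R_i}$ is finite. A set is arithmetical in $\vec{R}$ if it is definable by a first-order arithmetic formula with (a set coding) $\vec{R}$ as a parameter, equivalently if it is computable from some finite Turing jump of $\vec{R}$. "Computes" means Turing-computes. *)

theory Defs
  imports Main "HOL-Library.Nat_Bijection" "HOL-Library.Disjoint_Sets"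
begin

section \<open>Oracle Turing machines and Turing reducibility\<close>

text \<open>
  A machine has a two-way infinite work tape over the alphabet blank/stroke (\<^term>\<open>False\<close>/\<^term>\<open>True\<close>)
  and a read-only oracle tape, carrying the characteristic function of the oracle on the cells
  \<open>0, 1, 2, \<dots>\<close> and blanks (\<^term>\<open>None\<close>) on the negative cells.  A program is a finite table mapping
  (state, scanned oracle symbol, scanned work symbol) to
  (new state, symbol written on the work tape, oracle head move, work head move); if a key occurs
  twice, its first entry counts.  The machine halts when no entry applies.
\<close>

datatype move = Move_Left | Stay | Move_Right

fun shift :: "move \<Rightarrow> int" where
  "shift Move_Left = -1"
| "shift Stay = 0"
| "shift Move_Right = 1"

type_synonym program = "((nat \<times> bool option \<times> bool) \<times> (nat \<times> bool \<times> move \<times> move)) list"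

text \<open>State, oracle head position, work head position, work tape contents.\<close>

type_synonym config = "nat \<times> int \<times> int \<times> (int \<Rightarrow> bool)"

definition oracle_tape :: "nat set \<Rightarrow> int \<Rightarrow> bool option" where
  "oracle_tape X z = (if z < 0 then None else Some (nat z \<in> X))"

fun step :: "program \<Rightarrow> nat set \<Rightarrow> config \<Rightarrow> config option" where
  "step M X (q, i, k, w) =
     (case map_of M (q, oracle_tape X i, w k) of
        None \<Rightarrow> None
      | Some (q', b, d, d') \<Rightarrow> Some (q', i + shift d, k + shift d', w(k := b)))"

text \<open>The input \<open>x\<close> is given as \<open>x + 1\<close> consecutive strokes; the start state is \<open>0\<close>.\<close>

definition initial :: "nat \<Rightarrow> config" where
  "initial x = (0, 0, 0, \<lambda>z. 0 \<le> z \<and> z \<le> int x)"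

text \<open>The output is the number of strokes on the work tape when the machine halts.\<close>

definition tm_output :: "program \<Rightarrow> nat set \<Rightarrow> nat \<Rightarrow> nat \<Rightarrow> bool" where
  "tm_output M X x y \<longleftrightarrow>
     (\<exists>q i k w. (\<lambda>c c'. step M X c = Some c')\<^sup>*\<^sup>* (initial x) (q, i, k, w) \<and>
        step M X (q, i, k, w) = None \<and> card {z. w z} = y)"

definition computes :: "nat set \<Rightarrow> nat set \<Rightarrow> bool" where
  "computes X Y \<longleftrightarrow> (\<exists>M. \<forall>x. tm_output M X x (if x \<in> Y then 1 else 0))"


section \<open>Arithmetical definability with a set parameter\<close>

datatype arith_term =
  Var nat | Zero | One | Plus arith_term arith_term | Times arith_term arith_term

datatype arith_formula =
  Equal arith_term arith_term
| Less arith_term arith_term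
| Param arith_term
| Neg arith_formula
| Conj arith_formula arith_formula
| Exists nat arith_formula

primrec term_val :: "(nat \<Rightarrow> nat) \<Rightarrow> arith_term \<Rightarrow> nat" where
  "term_val e (Var v) = e v"
| "term_val e Zero = 0"
| "term_val e One = 1"
| "term_val e (Plus s t) = term_val e s + term_val e t"
| "term_val e (Times s t) = term_val e s * term_val e t"

text \<open>\<^term>\<open>Param t\<close> is the atomic formula stating that \<open>t\<close> belongs to the set parameter \<open>X\<close>.\<close>

primrec sat :: "nat set \<Rightarrow> (nat \<Rightarrow> nat) \<Rightarrow> arith_formula \<Rightarrow> bool" where
  "sat X e (Equal s t) \<longleftrightarrow> term_val e s = term_val e t"
| "sat X e (Less s t) \<longleftrightarrow> term_val e s < term_val e t"
| "sat X e (Param t) \<longleftrightarrow> term_val e t \<in> X"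
| "sat X e (Neg f) \<longleftrightarrow> \<not> sat X e f"
| "sat X e (Conj f g) \<longleftrightarrow> sat X e f \<and> sat X e g"
| "sat X e (Exists v f) \<longleftrightarrow> (\<exists>n. sat X (e(v := n)) f)"

text \<open>
  The formula defines the set through variable \<open>0\<close>; quantifying over all assignments \<open>e\<close> rules out
  any dependence on other free variables.
\<close>

definition arith_definable :: "nat set \<Rightarrow> nat set \<Rightarrow> bool" where
  "arith_definable X B \<longleftrightarrow> (\<exists>f. \<forall>e. sat X e f \<longleftrightarrow> e 0 \<in> B)"

definition seq_code :: "(nat \<Rightarrow> nat set) \<Rightarrow> nat set" where
  "seq_code R = {prod_encode (i, x) | i x. x \<in> R i}"

definition arithmetical_in :: "(nat \<Rightarrow> nat set) \<Rightarrow> nat set \<Rightarrow> bool" where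
  "arithmetical_in R B \<longleftrightarrow> arith_definable (seq_code R) B"


section \<open>Cohesive sets\<close>

definition cohesive :: "(nat \<Rightarrow> nat set) \<Rightarrow> nat set \<Rightarrow> bool" where
  "cohesive R S \<longleftrightarrow> infinite S \<and> (\<forall>i. finite (S \<inter> R i) \<or> finite (S \<inter> - R i))"

end

theory Submission
  imports Defs "HOL-Library.Countable_Set"
begin

text \<open>
  Let \<open>M\<close> be a countable family of sets of numbers, called reservoirs, that contains \<open>UNIV\<close> and a witness
  to every true statement of the form ``some infinite subset \<open>Y\<close> of the reservoir \<open>X\<close> has no finite
  subset \<open>E\<close> for which \<open>\<Phi> (F \<union> E)\<close> has an element above \<open>n\<close>''.  Let \<open>c\<close> be a colouring of the
  numbers that is generic over \<open>M\<close>, and put \<open>R i = {x. c x = i}\<close>.  Merging all colours \<open>\<ge> m\<close> turns every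
  cohesive set, up to finitely many elements, into a homogeneous set for an \<open>(m + 1)\<close>-colouring.

  For a cover \<open>A\<close> of the numbers by \<open>m\<close> sets, build \<open>S j \<subseteq> A j\<close> for all \<open>j < m\<close> simultaneously by
  Mathias forcing with reservoirs in \<open>M\<close>.  Given one functional for every \<open>j\<close>, either one of them can be
  starved, i.e. made to enumerate a finite set only, or compactness bounds how far one has to look for
  new elements, uniformly in the partition of the reservoir; by genericity these new elements may be
  assumed to have any prescribed colour.  As there are more colours than functionals, some functional
  enumerates two colours in the end.  Hence for some \<open>j\<close> all requirements on \<open>S j\<close> are met.
\<close>

section \<open>Finite use of oracle computations\<close>

lemma steps_finite_use:
  assumes "(\<lambda>c c'. step P X c = Some c')\<^sup>*\<^sup>* c0 c1"
  shows "\<exists>u. \<forall>X'. X' \<inter> {..<u} = X \<inter> {..<u} \<longrightarrow> (\<lambda>c c'. step P X' c = Some c')\<^sup>*\<^sup>* c0 c1"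
  using assms
proof (induction rule: rtranclp_induct)
  case base
  then show ?case by simp
next
  case (step y z)
  then obtain u where u: "\<And>X'. X' \<inter> {..<u} = X \<inter> {..<u} \<Longrightarrow> (\<lambda>c c'. step P X' c = Some c')\<^sup>*\<^sup>* c0 y"
    by blast
  obtain q i k w where y: "y = (q, i, k, w)" by (cases y)
  have "(\<lambda>c c'. step P X' c = Some c')\<^sup>*\<^sup>* c0 z"
    if eq: "X' \<inter> {..<max u (Suc (nat i))} = X \<inter> {..<max u (Suc (nat i))}" for X'
  proof -
    have mem: "v \<in> X' \<longleftrightarrow> v \<in> X" if "v < max u (Suc (nat i))" for v
      using eq that by blast
    have "X' \<inter> {..<u} = X \<inter> {..<u}" using mem by auto
    \<comment> \<open>For negative \<open>i\<close> the scanned symbol is \<open>None\<close>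
      whatever the oracle; otherwise the bound \<open>Suc (nat i)\<close> just covers the scanned
      cell.\<close>
    moreover have "oracle_tape X' i = oracle_tape X i"
      using mem[of "nat i"] by (simp add: oracle_tape_def)
    then have "step P X' y = Some z" using step(2) by (simp add: y)
    ultimately show ?thesis using u by (meson rtranclp.rtrancl_into_rtrancl)
  qed
  then show ?case by blast
qed

lemma step_finite_use:
  "\<exists>u. \<forall>X'. X' \<inter> {..<u} = X \<inter> {..<u} \<longrightarrow> step P X' c = step P X c"
proof -
  obtain q i k w where c: "c = (q, i, k, w)" by (cases c)
  have "step P X' c = step P X c" if "X' \<inter> {..<Suc (nat i)} = X \<inter> {..<Suc (nat i)}" for X'
  proof -
    have "nat i \<in> X' \<longleftrightarrow> nat i \<in> X" using that by blast
    then have "oracle_tape X' i = oracle_tape X i" by (simp add: oracle_tape_def)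
    then show ?thesis by (simp add: c)
  qed
  then show ?thesis by blast
qed

lemma tm_output_finite_use:
  assumes "tm_output P X x y"
  shows "\<exists>u. \<forall>X'. X' \<inter> {..<u} = X \<inter> {..<u} \<longrightarrow> tm_output P X' x y"
proof -
  obtain q i k w where run: "(\<lambda>c c'. step P X c = Some c')\<^sup>*\<^sup>* (initial x) (q, i, k, w)"
    and halt: "step P X (q, i, k, w) = None" and y: "card {z. w z} = y"
    using assms unfolding tm_output_def by blast
  obtain u where u: "\<And>X'. X' \<inter> {..<u} = X \<inter> {..<u} \<Longrightarrow>
      (\<lambda>c c'. step P X' c = Some c')\<^sup>*\<^sup>* (initial x) (q, i, k, w)"
    using steps_finite_use[OF run] by blast
  obtain v where v: "\<And>X'. X' \<inter> {..<v} = X \<inter> {..<v} \<Longrightarrow>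
      step P X' (q, i, k, w) = step P X (q, i, k, w)"
    using step_finite_use by blast
  have "tm_output P X' x y" if eq: "X' \<inter> {..<max u v} = X \<inter> {..<max u v}" for X'
  proof -
    have mem: "z \<in> X' \<longleftrightarrow> z \<in> X" if "z < max u v" for z using eq that by blast
    have "X' \<inter> {..<u} = X \<inter> {..<u}" "X' \<inter> {..<v} = X \<inter> {..<v}" using mem by auto
    then show ?thesis unfolding tm_output_def using u v halt y by metis
  qed
  then show ?thesis by blast
qed

lemma halting_config_unique:
  assumes "(\<lambda>c c'. step P X c = Some c')\<^sup>*\<^sup>* c0 c1" "step P X c1 = None"
    and "(\<lambda>c c'. step P X c = Some c')\<^sup>*\<^sup>* c0 c2" "step P X c2 = None"
  shows "c1 = c2"
  using assms
proof (induction rule: converse_rtranclp_induct)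
  case base
  from base(2) show ?case
    by (rule converse_rtranclpE) (use base(1) in auto)
next
  case (step y z)
  from step.prems(2) show ?case
  proof (rule converse_rtranclpE)
    assume "y = c2"
    then show ?thesis using step.hyps(1) step.prems(3) by simp
  next
    fix z' assume "step P X y = Some z'" "(\<lambda>c c'. step P X c = Some c')\<^sup>*\<^sup>* z' c2"
    then show ?thesis using step.hyps(1) step.IH step.prems(1,3) by simp
  qed
qed

lemma tm_output_unique:
  assumes "tm_output P X x y" "tm_output P X x y'"
  shows "y = y'"
proof -
  obtain q i k w where 1: "(\<lambda>c c'. step P X c = Some c')\<^sup>*\<^sup>* (initial x) (q, i, k, w)"
    "step P X (q, i, k, w) = None" "card {z. w z} = y"
    using assms(1) unfolding tm_output_def by blast
  obtain q' i' k' w' where 2: "(\<lambda>c c'. step P X c = Some c')\<^sup>*\<^sup>* (initial x) (q', i', k', w')"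
    "step P X (q', i', k', w') = None" "card {z. w' z} = y'"
    using assms(2) unfolding tm_output_def by blast
  have "(q, i, k, w) = (q', i', k', w')"
    using halting_config_unique 1(1,2) 2(1,2) by blast
  then show ?thesis using 1(3) 2(3) by simp
qed

text \<open>Makes \<open>program\<close> a countable type, so that machines can be indexed by
  numbers.\<close>

instance move :: countable by countable_datatype


section \<open>Choosing the sequence\<close>

text \<open>A Skolem hull: apply the choice functions \<open>g i\<close> to \<open>x0\<close> along
  all finite lists of indices, of which there are countably many.\<close>

lemma countable_choice_closure:
  fixes P :: "'i::countable \<Rightarrow> 'a \<Rightarrow> 'a \<Rightarrow> bool" and x0 :: 'a
  obtains M where "countable M" "x0 \<in> M"
    "\<And>i x y. x \<in> M \<Longrightarrow> P i x y \<Longrightarrow> \<exists>y\<in>M. P i x y"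
proof -
  define g where "g = (\<lambda>i x. SOME y. P i x y)"
  define M where "M = range (\<lambda>l. foldr g l x0)"
  have "countable M" by (simp add: M_def)
  have "x0 \<in> M" unfolding M_def by (rule range_eqI[of _ _ "[]"]) simp
  have closed: "\<exists>y\<in>M. P i x y" if "x \<in> M" "P i x y" for i x y
  proof
    obtain l where "x = foldr g l x0" using \<open>x \<in> M\<close> by (auto simp: M_def)
    then show "g i x \<in> M" unfolding M_def by (intro range_eqI[of _ _ "i # l"]) simp
    show "P i x (g i x)" unfolding g_def using that(2) by (rule someI)
  qed
  show ?thesis by (rule that[OF \<open>countable M\<close> \<open>x0 \<in> M\<close>]) (rule closed)
qed

text \<open>Each pair of a requirement and a colour gets its own stage, at which the next block of
  numbers is painted in that colour, far enough to meet the requirement.\<close>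

lemma generic_coloring:
  fixes \<Q> :: "(nat \<Rightarrow> nat \<Rightarrow> bool) set"
  assumes "countable \<Q>"
  shows "\<exists>c :: nat \<Rightarrow> nat. \<forall>Q\<in>\<Q>. (\<forall>n. \<exists>N. Q n N) \<longrightarrow>
    (\<forall>i. \<exists>n N. Q n N \<and> (\<forall>x. n < x \<and> x \<le> N \<longrightarrow> c x = i))"
proof -
  define \<Q>' where "\<Q>' = insert (\<lambda>_ _. True) {Q \<in> \<Q>. \<forall>n. \<exists>N. Q n N}"
  have "countable \<Q>'" unfolding \<Q>'_def using assms by simp
  define Q where "Q s = from_nat_into \<Q>' (fst (prod_decode s))" for s
  define col where "col s = snd (prod_decode s)" for s
  \<comment> \<open>Block \<open>s\<close> runs from \<open>p s\<close> (excluded) to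
    \<open>p (Suc s)\<close> (included). The maximum keeps \<open>p\<close> monotone even if the
    chosen \<open>N\<close> is small.\<close>
  define p where "p = rec_nat 0 (\<lambda>s n. max n (SOME N. Q s n N))"
  have p_Suc: "p (Suc s) = max (p s) (SOME N. Q s (p s) N)" for s by (simp add: p_def)
  have p_mono: "mono p" by (rule mono_iff_le_Suc[THEN iffD2]) (simp add: p_Suc)
  define c where "c x = col (LEAST s. x \<le> p (Suc s))" for x
  have "\<exists>n N. q n N \<and> (\<forall>x. n < x \<and> x \<le> N \<longrightarrow> c x = i)"
    if "q \<in> \<Q>" and ex: "\<forall>n. \<exists>N. q n N" for q i
  proof -
    have "q \<in> \<Q>'" using that by (simp add: \<Q>'_def)
    then obtain t where t: "from_nat_into \<Q>' t = q"
      using \<open>countable \<Q>'\<close> by (metis from_nat_into_to_nat_on)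
    define s where "s = prod_encode (t, i)"
    have Qs: "Q s = q" and cs: "col s = i" by (simp_all add: Q_def col_def s_def t)
    define N where "N = (SOME N. Q s (p s) N)"
    have "q (p s) N" unfolding N_def Qs using ex by (blast intro: someI_ex)
    moreover have "c x = i" if "p s < x" "x \<le> N" for x
    proof -
      have "(LEAST s. x \<le> p (Suc s)) = s"
      proof (rule Least_equality)
        show "x \<le> p (Suc s)" using that by (simp add: p_Suc N_def)
        fix r assume "x \<le> p (Suc r)"
        then have "p s < p (Suc r)" using that by simp
        then show "s \<le> r" using monoD[OF p_mono, of "Suc r" s] by (metis not_less not_less_eq_eq)
      qed
      then show ?thesis by (simp add: c_def cs)
    qed
    ultimately show ?thesis by blast
  qed
  then show ?thesis by blast
qed


section \<open>Starving a functional\<close>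

text \<open>Restricting to finite \<open>E\<close> loses nothing for functionals of finite use, and
  lets a violation be seen from finitely many values of a partition.\<close>

definition starves :: "(nat set \<Rightarrow> nat set) \<Rightarrow> nat set \<Rightarrow> nat \<Rightarrow> nat set \<Rightarrow> bool" where
  "starves \<Psi> F n Y \<longleftrightarrow> (\<forall>E x. finite E \<and> E \<subseteq> Y \<and> n < x \<longrightarrow> x \<notin> \<Psi> (F \<union> E))"

text \<open>A function \<open>h\<close> with values below \<open>m\<close> stands for a partition of \<open>X\<close> into \<open>m\<close> parts.\<close>

definition hits ::
  "(nat \<Rightarrow> nat set \<Rightarrow> nat set) \<Rightarrow> nat \<Rightarrow> (nat \<Rightarrow> nat) \<Rightarrow> (nat \<Rightarrow> nat set) \<Rightarrow> nat set \<Rightarrow> nat \<Rightarrow> nat \<Rightarrow> bool"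
where
  "hits \<Phi> m e F X n N \<longleftrightarrow> (\<forall>h. (\<forall>y. h y < m) \<longrightarrow>
     (\<exists>j<m. \<exists>E x. finite E \<and> E \<subseteq> {y \<in> X. h y = j} \<and> n < x \<and> x \<le> N \<and> x \<in> \<Phi> (e j) (F j \<union> E)))"

text \<open>Lets finite lists of numbers code the parameters \<open>e\<close> and \<open>F\<close>,
  which leaves countably many requirements per reservoir.\<close>

lemma hits_cong:
  assumes "\<And>j. j < m \<Longrightarrow> e j = e' j" "\<And>j. j < m \<Longrightarrow> F j = F' j"
  shows "hits \<Phi> m e F X = hits \<Phi> m e' F' X"
  using assms by (intro ext) (simp add: hits_def cong: conj_cong)

text \<open>Koenig's lemma: fix the values of \<open>f\<close> one by one, keeping infinitely many
  \<open>h N\<close> in agreement. By pigeonhole one of the \<open>m\<close> possible values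
  preserves this.\<close>

lemma coloring_compactness:
  fixes h :: "nat \<Rightarrow> nat \<Rightarrow> nat"
  assumes "\<And>N y. h N y < m"
  obtains f where "\<And>y. f y < m" "\<And>p. infinite {N. \<forall>y<p. h N y = f y}"
proof -
  define ok where "ok p f \<longleftrightarrow> infinite {N. \<forall>y<p. h N y = f y}" for p and f :: "nat \<Rightarrow> nat"
  have step: "\<exists>v. v < m \<and> ok (Suc p) (f(p := v))" if "ok p f" for p f
  proof (rule ccontr)
    assume neg: "\<not> ?thesis"
    have "{N. \<forall>y<p. h N y = f y} \<subseteq> (\<Union>v<m. {N. \<forall>y<Suc p. h N y = (f(p := v)) y})"
      using assms by (auto simp: less_Suc_eq)
    moreover have "finite (\<Union>v<m. {N. \<forall>y<Suc p. h N y = (f(p := v)) y})"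
      using neg unfolding ok_def by blast
    ultimately show False using that unfolding ok_def by (meson finite_subset)
  qed
  have "\<exists>g. \<forall>p. ok p (g p) \<and> (\<exists>v<m. g (Suc p) = (g p)(p := v))"
  proof (rule dependent_nat_choice)
    show "\<exists>f. ok 0 f" by (simp add: ok_def)
    show "\<exists>g. ok (Suc p) g \<and> (\<exists>v<m. g = f(p := v))" if "ok p f" for p f
      using step[OF that] by blast
  qed
  then obtain g where g: "\<And>p. ok p (g p)" and g_Suc: "\<And>p. \<exists>v<m. g (Suc p) = (g p)(p := v)"
    by blast
  \<comment> \<open>Later stages only change later arguments, so the diagonal agrees with
    \<open>g p\<close> below \<open>p\<close>.\<close>
  have stable: "g p y = g (Suc y) y" if "y < p" for p y
    using that
  proof (induction p)
    case (Suc p)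
    then show ?case using g_Suc[of p] by (cases "y = p") auto
  qed simp
  show ?thesis
  proof (rule that[of "\<lambda>y. g (Suc y) y"])
    show "g (Suc y) y < m" for y using g_Suc[of y] by auto
    have "(\<forall>y<p. h N y = g (Suc y) y) \<longleftrightarrow> (\<forall>y<p. h N y = g p y)" for N p
      using stable[of _ p] by metis
    then show "infinite {N. \<forall>y<p. h N y = g (Suc y) y}" for p
      using g[of p] by (simp add: ok_def)
  qed
qed

text \<open>If every bound \<open>N\<close> fails for some partition \<open>h N\<close>, then all
  parts of a limit partition \<open>f\<close> starve their functionals, and one of these parts is
  infinite.\<close>

lemma hits_or_starves:
  assumes "infinite X"
    and no: "\<And>j Y. j < m \<Longrightarrow> Y \<subseteq> X \<Longrightarrow> infinite Y \<Longrightarrow> \<not> starves (\<Phi> (e j)) (F j) n Y"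
  shows "\<exists>N. hits \<Phi> m e F X n N"
proof (rule ccontr)
  assume "\<not> ?thesis"
  then have "\<forall>N. \<exists>h. (\<forall>y. h y < m) \<and> \<not> (\<exists>j<m. \<exists>E x. finite E \<and> E \<subseteq> {y \<in> X. h y = j} \<and>
      n < x \<and> x \<le> N \<and> x \<in> \<Phi> (e j) (F j \<union> E))"
    unfolding hits_def not_ex not_all not_imp .
  from choice[OF this] obtain h where H: "\<forall>N. (\<forall>y. h N y < m) \<and> \<not> (\<exists>j<m. \<exists>E x. finite E \<and>
      E \<subseteq> {y \<in> X. h N y = j} \<and> n < x \<and> x \<le> N \<and> x \<in> \<Phi> (e j) (F j \<union> E))"
    by (rule exE)
  then have h: "h N y < m" for N y by simp
  have miss: "\<not> (\<exists>j<m. \<exists>E x. finite E \<and> E \<subseteq> {y \<in> X. h N y = j} \<and>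
      n < x \<and> x \<le> N \<and> x \<in> \<Phi> (e j) (F j \<union> E))" for N
    using H[THEN spec, of N] by (rule conjunct2)
  obtain f where f: "\<And>y. f y < m" and inf: "\<And>p. infinite {N. \<forall>y<p. h N y = f y}"
    using coloring_compactness[of h, OF h] by blast
  have starve: "starves (\<Phi> (e j)) (F j) n {y \<in> X. f y = j}" if "j < m" for j
    unfolding starves_def
  proof (intro allI impI; elim conjE)
    fix E x assume E: "finite E" "E \<subseteq> {y \<in> X. f y = j}" and "n < x"
    obtain p where p: "\<And>y. y \<in> E \<Longrightarrow> y < p"
      using E(1) finite_nat_set_iff_bounded by auto
    \<comment> \<open>\<open>N\<close> must agree with \<open>f\<close> on \<open>E\<close> and also
      reach \<open>x\<close>, so that the failure of \<open>h N\<close> speaks about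
      \<open>x\<close>.\<close>
    obtain N where "x \<le> N" and N: "\<forall>y<p. h N y = f y"
      using inf[of p] unfolding infinite_nat_iff_unbounded_le by blast
    have "E \<subseteq> {y \<in> X. h N y = j}" using E(2) p N by auto
    then show "x \<notin> \<Phi> (e j) (F j \<union> E)" using miss[of N] that E(1) \<open>n < x\<close> \<open>x \<le> N\<close> by blast
  qed
  have "X = (\<Union>j<m. {y \<in> X. f y = j})" using f by auto
  then have "\<exists>j<m. infinite {y \<in> X. f y = j}"
    using \<open>infinite X\<close> by (metis (no_types, lifting) finite_UN finite_lessThan lessThan_iff)
  then obtain j where j: "j < m" "infinite {y \<in> X. f y = j}" by blast
  show False using no[OF j(1) _ j(2)] starve[OF j(1)] by auto
qed


section \<open>Forcing with reservoirs\<close>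

locale reservoir_forcing =
  fixes \<Phi> :: "nat \<Rightarrow> nat set \<Rightarrow> nat set"
    and M :: "nat set set" and c :: "nat \<Rightarrow> nat"
    and m :: nat and A :: "nat \<Rightarrow> nat set" and X0 :: "nat set"
  assumes finite_use: "x \<in> \<Phi> e S \<Longrightarrow> \<exists>u. \<forall>S'. S' \<inter> {..<u} = S \<inter> {..<u} \<longrightarrow> x \<in> \<Phi> e S'"
    and truncate: "X \<in> M \<Longrightarrow> X - {..<u} \<in> M"
    and starve: "X \<in> M \<Longrightarrow> finite F \<Longrightarrow> Y \<subseteq> X \<Longrightarrow> infinite Y \<Longrightarrow> starves (\<Phi> e) F n Y \<Longrightarrow>
      \<exists>Y\<in>M. Y \<subseteq> X \<and> infinite Y \<and> starves (\<Phi> e) F n Y"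
    and generic: "X \<in> M \<Longrightarrow> \<forall>j<m. finite (G j) \<Longrightarrow> \<forall>n. \<exists>N. hits \<Phi> m d G X n N \<Longrightarrow>
      \<exists>n N. hits \<Phi> m d G X n N \<and> (\<forall>x. n < x \<and> x \<le> N \<longrightarrow> c x = i)"
    and X0: "X0 \<in> M" "infinite X0" "X0 \<subseteq> (\<Union>j<m. A j)"
    and meets: "X \<in> M \<Longrightarrow> X \<subseteq> X0 \<Longrightarrow> infinite X \<Longrightarrow> j < m \<Longrightarrow> infinite (X \<inter> A j)"
begin

text \<open>Mathias conditions with \<open>m\<close> finite stems and one shared reservoir. Only the
  stems respect the parts \<open>A j\<close>; the reservoir is not split along them, so it can stay
  in \<open>M\<close>.\<close>

definition cond :: "(nat \<Rightarrow> nat set) \<times> nat set \<Rightarrow> bool" where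
  "cond p \<longleftrightarrow> snd p \<in> M \<and> infinite (snd p) \<and> snd p \<subseteq> X0 \<and>
     (\<forall>j<m. finite (fst p j) \<and> fst p j \<subseteq> A j)"

definition extends :: "(nat \<Rightarrow> nat set) \<times> nat set \<Rightarrow> (nat \<Rightarrow> nat set) \<times> nat set \<Rightarrow> bool" where
  "extends q p \<longleftrightarrow> snd q \<subseteq> snd p \<and> (\<forall>j<m. fst p j \<subseteq> fst q j \<and> fst q j \<subseteq> fst p j \<union> snd p)"

text \<open>All sets compatible with the condition count, not only subsets of \<open>A j\<close>;
  hence extensions inherit what is forced.\<close>

definition forces :: "(nat \<Rightarrow> nat set) \<times> nat set \<Rightarrow> nat \<Rightarrow> (nat set \<Rightarrow> bool) \<Rightarrow> bool" where
  "forces p j \<phi> \<longleftrightarrow> (\<forall>S. fst p j \<subseteq> S \<and> S \<subseteq> fst p j \<union> snd p \<longrightarrow> \<phi> S)"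

lemma extends_refl: "extends p p"
  by (auto simp: extends_def)

lemma extends_trans:
  assumes "extends r q" "extends q p"
  shows "extends r p"
  unfolding extends_def
proof (intro conjI allI impI)
  show "snd r \<subseteq> snd p" using assms by (auto simp: extends_def)
  fix j assume "j < m"
  then have "fst q j \<subseteq> fst r j" "fst r j \<subseteq> fst q j \<union> snd q" "fst p j \<subseteq> fst q j"
    "fst q j \<subseteq> fst p j \<union> snd p" "snd q \<subseteq> snd p"
    using assms by (simp_all add: extends_def)
  then show "fst p j \<subseteq> fst r j" "fst r j \<subseteq> fst p j \<union> snd p" by blast+
qed

lemma forces_extends:
  assumes "forces p j \<phi>" "extends q p" "j < m"
  shows "forces q j \<phi>"
  unfolding forces_def
proof (intro allI impI)
  fix S assume "fst q j \<subseteq> S \<and> S \<subseteq> fst q j \<union> snd q"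
  moreover have "fst p j \<subseteq> fst q j" "fst q j \<subseteq> fst p j \<union> snd p" "snd q \<subseteq> snd p"
    using assms(2,3) by (simp_all add: extends_def)
  ultimately have "fst p j \<subseteq> S \<and> S \<subseteq> fst p j \<union> snd p" by blast
  then show "\<phi> S" using assms(1) by (simp add: forces_def)
qed

text \<open>Either some functional can be starved by shrinking the reservoir, or \<open>hits\<close>
  has a bound beyond every \<open>n\<close>. Then genericity yields such an interval painted
  entirely in colour \<open>i\<close>, and the partition given by \<open>A\<close> must produce an
  element there.\<close>

lemma force_color:
  assumes p: "cond p"
  shows "(\<exists>q j. cond q \<and> extends q p \<and> j < m \<and> forces q j (\<lambda>S. finite (\<Phi> (d j) S))) \<or>
    (\<exists>q j x. cond q \<and> extends q p \<and> j < m \<and> c x = i \<and> forces q j (\<lambda>S. x \<in> \<Phi> (d j) S))"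
proof -
  obtain F X where FX: "p = (F, X)" by (cases p)
  have X: "X \<in> M" "infinite X" "X \<subseteq> X0" and F: "\<And>j. j < m \<Longrightarrow> finite (F j)" "\<And>j. j < m \<Longrightarrow> F j \<subseteq> A j"
    using p by (auto simp: cond_def FX)
  show ?thesis
  proof (cases "\<exists>n. \<exists>j<m. \<exists>Y\<subseteq>X. infinite Y \<and> starves (\<Phi> (d j)) (F j) n Y")
    case True
    then obtain n j where "j < m" and "\<exists>Y\<in>M. Y \<subseteq> X \<and> infinite Y \<and> starves (\<Phi> (d j)) (F j) n Y"
      using starve X(1) F(1) by meson
    then obtain Y where Y: "Y \<in> M" "Y \<subseteq> X" "infinite Y" and st: "starves (\<Phi> (d j)) (F j) n Y" by blast
    have "finite (\<Phi> (d j) S)" if S: "F j \<subseteq> S" "S \<subseteq> F j \<union> Y" for S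
    proof -
      have "x \<le> n" if x: "x \<in> \<Phi> (d j) S" for x
      proof (rule ccontr)
        assume "\<not> x \<le> n"
        obtain u where u: "\<And>S'. S' \<inter> {..<u} = S \<inter> {..<u} \<Longrightarrow> x \<in> \<Phi> (d j) S'"
          using finite_use[OF x] by blast
        define E where "E = S \<inter> Y \<inter> {..<u}"
        have "(F j \<union> E) \<inter> {..<u} = S \<inter> {..<u}" using S by (auto simp: E_def)
        then have "x \<in> \<Phi> (d j) (F j \<union> E)" by (rule u)
        moreover have "finite E" "E \<subseteq> Y" by (auto simp: E_def)
        ultimately show False using st \<open>\<not> x \<le> n\<close> unfolding starves_def by auto
      qed
      then show ?thesis by (meson finite_nat_set_iff_bounded_le)
    qed
    then have "forces (F, Y) j (\<lambda>S. finite (\<Phi> (d j) S))" by (simp add: forces_def)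
    moreover have "cond (F, Y)" "extends (F, Y) p"
      using Y X F by (auto simp: cond_def extends_def FX)
    ultimately show ?thesis using \<open>j < m\<close> by blast
  next
    case False
    then have "\<forall>n. \<exists>N. hits \<Phi> m d F X n N"
      using hits_or_starves[OF X(2), where m = m and \<Phi> = \<Phi> and e = d and F = F] by blast
    then obtain n N where hit: "hits \<Phi> m d F X n N" and col: "\<And>x. n < x \<Longrightarrow> x \<le> N \<Longrightarrow> c x = i"
      using generic[OF X(1), where G = F and d = d and i = i] F(1) by blast
    have "m > 0" using X0(2,3) by (cases m) auto
    \<comment> \<open>The sets \<open>A j\<close> may overlap, so \<open>h\<close> selects one for
      each point of \<open>X0\<close>; the default \<open>0\<close> is a legal value because
      \<open>m > 0\<close>.\<close>
    define h where "h y = (if y \<in> X0 then SOME j. j < m \<and> y \<in> A j else 0)" for y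
    have h: "h y < m \<and> y \<in> A (h y)" if "y \<in> X0" for y
      unfolding h_def using that X0(3) by simp (rule someI_ex, blast)
    have "\<forall>y. h y < m" using h \<open>m > 0\<close> by (metis h_def)
    from hit[unfolded hits_def, THEN spec, THEN mp, OF this]
    obtain j E x where j: "j < m" and E: "finite E" "E \<subseteq> {y \<in> X. h y = j}"
      and x: "n < x" "x \<le> N" "x \<in> \<Phi> (d j) (F j \<union> E)"
      by blast
    obtain u where u: "\<And>S'. S' \<inter> {..<u} = (F j \<union> E) \<inter> {..<u} \<Longrightarrow> x \<in> \<Phi> (d j) S'"
      using finite_use[OF x(3)] by blast
    \<comment> \<open>Removing the numbers below the use \<open>u\<close> from the reservoir
      protects the computation in all further extensions.\<close>
    define q where "q = (F(j := F j \<union> E), X - {..<u})"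
    have "E \<subseteq> A j" using E(2) X(3) h by blast
    moreover have "infinite (X - {..<u})" using X(2) by (simp add: Diff_infinite_finite)
    ultimately have "cond q"
      using X truncate[OF X(1)] F E(1) by (auto simp: cond_def q_def)
    moreover have "extends q p" using E(2) by (auto simp: extends_def q_def FX)
    moreover have "forces q j (\<lambda>S. x \<in> \<Phi> (d j) S)"
      unfolding forces_def by (intro allI impI u) (auto simp: q_def)
    ultimately show ?thesis using j col[OF x(1,2)] by blast
  qed
qed

text \<open>The negation describes an infinite set that is homogeneous for the merged colouring, as
  a tail of a cohesive set would be.\<close>

definition inhomogeneous :: "nat \<Rightarrow> nat set \<Rightarrow> bool" where
  "inhomogeneous e S \<longleftrightarrow> finite (\<Phi> e S) \<or> (\<exists>x\<in>\<Phi> e S. \<exists>y\<in>\<Phi> e S. min (c x) m \<noteq> min (c y) m)"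

text \<open>
  There are \<open>m + 1\<close> colours for the \<open>m\<close> functionals: always asking for a colour that no functional
  has produced yet, after at most \<open>m + 1\<close> rounds some functional has produced two.
\<close>

lemma force_inhomogeneous:
  assumes p: "cond p"
  shows "\<exists>q j. cond q \<and> extends q p \<and> j < m \<and> forces q j (inhomogeneous (d j))"
proof (rule ccontr)
  assume neg: "\<not> ?thesis"
  \<comment> \<open>\<open>T\<close> holds the \<open>t\<close> indices whose functionals have been
    forced to produce an element, of colour \<open>col j\<close>; it gains one index per
    round.\<close>
  have "\<exists>q T col. cond q \<and> extends q p \<and> T \<subseteq> {..<m} \<and> card T = t \<and>
      (\<forall>j\<in>T. col j \<le> m \<and> (\<exists>x. c x = col j \<and> forces q j (\<lambda>S. x \<in> \<Phi> (d j) S)))" for t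
  proof (induction t)
    case 0
    show ?case
      by (rule exI[of _ p], rule exI[of _ "{}"]) (simp add: p extends_refl)
  next
    case (Suc t)
    then obtain q T and col :: "nat \<Rightarrow> nat" where q: "cond q" "extends q p" and T: "T \<subseteq> {..<m}" "card T = t"
      and col: "\<And>j. j \<in> T \<Longrightarrow> col j \<le> m"
        "\<And>j. j \<in> T \<Longrightarrow> \<exists>x. c x = col j \<and> forces q j (\<lambda>S. x \<in> \<Phi> (d j) S)"
      by blast
    have "finite T" using T(1) finite_subset by blast
    have "card (col ` T) \<le> m"
      using card_image_le[OF \<open>finite T\<close>, of col] card_mono[OF _ T(1)] by simp
    then have "\<not> {..m} \<subseteq> col ` T"
      using card_mono[of "col ` T" "{..m}"] \<open>finite T\<close> by auto
    then obtain i where i: "i \<le> m" "i \<notin> col ` T" by auto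
    have "\<not> (\<exists>r j. cond r \<and> extends r q \<and> j < m \<and> forces r j (\<lambda>S. finite (\<Phi> (d j) S)))"
    proof
      assume "\<exists>r j. cond r \<and> extends r q \<and> j < m \<and> forces r j (\<lambda>S. finite (\<Phi> (d j) S))"
      then obtain r j where r: "cond r" "extends r q" "j < m" "forces r j (\<lambda>S. finite (\<Phi> (d j) S))"
        by blast
      then have "forces r j (inhomogeneous (d j))" by (simp add: forces_def inhomogeneous_def)
      then show False using neg r(1,3) extends_trans[OF r(2) q(2)] by blast
    qed
    then obtain r j x where r: "cond r" "extends r q" and j: "j < m" "c x = i"
      and x: "forces r j (\<lambda>S. x \<in> \<Phi> (d j) S)"
      using force_color[OF q(1), of d i] by blast
    have rp: "extends r p" using r(2) q(2) extends_trans by blast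
    have "j \<notin> T"
    proof
      assume "j \<in> T"
      then obtain y where y: "c y = col j" "forces q j (\<lambda>S. y \<in> \<Phi> (d j) S)" using col(2) by blast
      have "forces r j (\<lambda>S. y \<in> \<Phi> (d j) S)" using forces_extends y(2) r(2) j(1) by blast
      moreover have "min (c x) m \<noteq> min (c y) m"
        using i \<open>j \<in> T\<close> col(1) y(1) j(2) by fastforce
      ultimately have "forces r j (inhomogeneous (d j))"
        using x unfolding forces_def inhomogeneous_def by blast
      then show False using neg r(1) rp j(1) by blast
    qed
    have old: "\<exists>x. c x = col k \<and> forces r k (\<lambda>S. x \<in> \<Phi> (d k) S)" if "k \<in> T" for k
      using col(2)[OF that] forces_extends r(2) that T(1) by blast
    show ?case
    proof (intro exI conjI)
      show "cond r" "extends r p" by fact+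
      show "insert j T \<subseteq> {..<m}" using T(1) j(1) by simp
      show "card (insert j T) = Suc t" using \<open>finite T\<close> \<open>j \<notin> T\<close> T(2) by simp
      show "\<forall>k\<in>insert j T. (col(j := i)) k \<le> m \<and>
          (\<exists>x. c x = (col(j := i)) k \<and> forces r k (\<lambda>S. x \<in> \<Phi> (d k) S))"
        using old col(1) i(1) j x \<open>j \<notin> T\<close> by auto
    qed
  qed
  \<comment> \<open>The case \<open>t = Suc m\<close> asks for more indices than there are
    functionals.\<close>
  then obtain T :: "nat set" where "T \<subseteq> {..<m}" "card T = Suc m" by blast
  then show False using card_mono[of "{..<m}" T] by simp
qed

text \<open>By \<open>meets\<close> the reservoir has large elements in every part; iterating this
  makes all \<open>S j\<close> infinite.\<close>

lemma force_large:
  assumes p: "cond p"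
  shows "\<exists>q. cond q \<and> extends q p \<and> (\<forall>j<m. \<exists>x\<in>fst q j. b \<le> x)"
proof -
  obtain F X where FX: "p = (F, X)" by (cases p)
  have X: "X \<in> M" "infinite X" "X \<subseteq> X0" and F: "\<And>j. j < m \<Longrightarrow> finite (F j)" "\<And>j. j < m \<Longrightarrow> F j \<subseteq> A j"
    using p by (auto simp: cond_def FX)
  have "\<exists>x. j < m \<longrightarrow> x \<in> X \<inter> A j \<and> b \<le> x" for j
    using meets[OF X(1,3,2)] unfolding infinite_nat_iff_unbounded_le by blast
  then obtain g where g: "\<And>j. j < m \<Longrightarrow> g j \<in> X \<inter> A j \<and> b \<le> g j" by metis
  define q where "q = (\<lambda>j. insert (g j) (F j), X)"
  have "cond q" "extends q p" "\<forall>j<m. \<exists>x\<in>fst q j. b \<le> x"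
    using X F g by (auto simp: q_def cond_def extends_def FX)
  then show ?thesis by blast
qed

text \<open>Stage \<open>s\<close> treats the tuple of functionals coded by \<open>s\<close>, and
  succeeds for one member only. Since every tuple is treated, some single \<open>j\<close> succeeds
  for all \<open>e\<close>.\<close>

theorem inhomogeneous_solution:
  "\<exists>j<m. \<exists>S. infinite S \<and> S \<subseteq> A j \<and> (\<forall>e. inhomogeneous e S)"
proof -
  define d where "d s j = list_decode s ! j" for s j
  have "\<exists>f. \<forall>s. cond (f s) \<and> (extends (f (Suc s)) (f s) \<and> (\<forall>j<m. \<exists>x\<in>fst (f (Suc s)) j. s \<le> x) \<and>
      (\<exists>j<m. forces (f (Suc s)) j (inhomogeneous (d s j))))"
  proof (rule dependent_nat_choice)
    show "\<exists>p. cond p" using X0(1,2) by (intro exI[of _ "(\<lambda>_. {}, X0)"]) (simp add: cond_def)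
    fix p s assume "cond p"
    then obtain q where q: "cond q" "extends q p" "\<forall>j<m. \<exists>x\<in>fst q j. s \<le> x"
      using force_large by blast
    obtain r j where r: "cond r" "extends r q" "j < m" "forces r j (inhomogeneous (d s j))"
      using force_inhomogeneous[OF q(1)] by blast
    have "\<forall>j<m. \<exists>x\<in>fst r j. s \<le> x" using q(3) r(2) unfolding extends_def by blast
    then show "\<exists>r. cond r \<and> (extends r p \<and> (\<forall>j<m. \<exists>x\<in>fst r j. s \<le> x) \<and>
        (\<exists>j<m. forces r j (inhomogeneous (d s j))))"
      using r q(2) extends_trans by blast
  qed
  then obtain f where f: "\<And>s. cond (f s)" "\<And>s. extends (f (Suc s)) (f s)"
    and large: "\<And>s j. j < m \<Longrightarrow> \<exists>x\<in>fst (f (Suc s)) j. s \<le> x"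
    and forced: "\<And>s. \<exists>j<m. forces (f (Suc s)) j (inhomogeneous (d s j))"
    by blast
  have ext: "extends (f t) (f s)" if "s \<le> t" for s t
    using that by (induction rule: dec_induct) (use extends_refl extends_trans f(2) in blast)+
  define S where "S j = (\<Union>s. fst (f s) j)" for j
  have S_in: "fst (f s) j \<subseteq> S j \<and> S j \<subseteq> fst (f s) j \<union> snd (f s)" if "j < m" for s j
  proof -
    have "fst (f t) j \<subseteq> fst (f s) j \<union> snd (f s)" for t
    proof (cases "s \<le> t")
      case True then show ?thesis using ext that by (auto simp: extends_def)
    next
      case False
      then have "extends (f s) (f t)" using ext by simp
      then show ?thesis using that by (auto simp: extends_def)
    qed
    then show ?thesis by (auto simp: S_def)
  qed
  have S_inf: "infinite (S j)" if "j < m" for j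
    unfolding infinite_nat_iff_unbounded_le
  proof
    fix b
    show "\<exists>n\<ge>b. n \<in> S j" using large[OF that, of b] S_in[OF that] by blast
  qed
  have S_A: "S j \<subseteq> A j" if "j < m" for j
    using f(1) that by (auto simp: S_def cond_def)
  have "\<exists>j<m. \<forall>e. inhomogeneous e (S j)"
  proof (rule ccontr)
    assume "\<not> ?thesis"
    then obtain g where g: "\<And>j. j < m \<Longrightarrow> \<not> inhomogeneous (g j) (S j)" by metis
    \<comment> \<open>If each \<open>S j\<close> failed for some \<open>g j\<close>, the stage
      treating the tuple \<open>g\<close> would have repaired one of these failures.\<close>
    define s where "s = list_encode (map g [0..<m])"
    obtain j where j: "j < m" "forces (f (Suc s)) j (inhomogeneous (d s j))" using forced by blast
    have "d s j = g j" using j(1) by (simp add: d_def s_def)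
    then show False using g j S_in[OF j(1)] unfolding forces_def by metis
  qed
  then show ?thesis using S_inf S_A by blast
qed

end

section \<open>One generic colouring for all finite covers\<close>

lemma exists_generic_coloring:
  fixes \<Phi> :: "nat \<Rightarrow> nat set \<Rightarrow> nat set"
  assumes use: "\<And>e S x. x \<in> \<Phi> e S \<Longrightarrow> \<exists>u. \<forall>S'. S' \<inter> {..<u} = S \<inter> {..<u} \<longrightarrow> x \<in> \<Phi> e S'"
  shows "\<exists>c :: nat \<Rightarrow> nat. \<forall>m A. (\<Union>j<m. A j) = UNIV \<longrightarrow>
    (\<exists>j<m. \<exists>S. infinite S \<and> S \<subseteq> A j \<and>
      (\<forall>e k. infinite (\<Phi> e S) \<longrightarrow> (\<exists>x\<in>\<Phi> e S. min (c x) m \<noteq> k)))"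
proof -
  \<comment> \<open>Left indices close \<open>M\<close> under cutting off initial segments, right
    indices under choosing starving subsets. Stems are coded as numbers to keep the index type
    countable. Only \<open>\<Phi>\<close> enters, so \<open>M\<close> and later \<open>c\<close> are
    fixed before \<open>m\<close> and \<open>A\<close>.\<close>
  define P :: "nat + nat \<times> nat \<times> nat \<Rightarrow> nat set \<Rightarrow> nat set \<Rightarrow> bool" where
    "P = case_sum (\<lambda>u X Y. Y = X - {..<u})
       (\<lambda>(e, f, n) X Y. Y \<subseteq> X \<and> infinite Y \<and> starves (\<Phi> e) (set_decode f) n Y)"
  obtain M where "countable M" "UNIV \<in> M" and M: "\<And>i X Y. X \<in> M \<Longrightarrow> P i X Y \<Longrightarrow> \<exists>Y\<in>M. P i X Y"
    using countable_choice_closure[of UNIV P] by blast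
  have trunc: "X - {..<u} \<in> M" if "X \<in> M" for X u
    using M[OF that, of "Inl u"] by (simp add: P_def)
  have starve: "\<exists>Y\<in>M. Y \<subseteq> X \<and> infinite Y \<and> starves (\<Phi> e) F n Y"
    if "X \<in> M" "finite F" "Y \<subseteq> X" "infinite Y" "starves (\<Phi> e) F n Y" for X Y F e n
    using M[OF that(1), of "Inr (e, set_encode F, n)" Y] that by (simp add: P_def)
  define H where "H = (\<lambda>(X, m, es, fs). hits \<Phi> m (\<lambda>j. es ! j) (\<lambda>j. set_decode (fs ! j)) X)"
  have "countable (H ` (M \<times> (UNIV :: (nat \<times> nat list \<times> nat list) set)))"
    using \<open>countable M\<close> by (intro countable_image countable_SIGMA) auto
  from generic_coloring[OF this]
  obtain c :: "nat \<Rightarrow> nat" where c: "\<forall>Q\<in>H ` (M \<times> UNIV). (\<forall>n. \<exists>N. Q n N) \<longrightarrow>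
      (\<forall>i. \<exists>n N. Q n N \<and> (\<forall>x. n < x \<and> x \<le> N \<longrightarrow> c x = i))"
    by (rule exE)
  have hits_H: "hits \<Phi> m d F X \<in> H ` (M \<times> UNIV)" if "X \<in> M" "\<forall>j<m. finite (F j)" for m d F X
  proof -
    have "hits \<Phi> m d F X = H (X, m, map d [0..<m], map (\<lambda>j. set_encode (F j)) [0..<m])"
      unfolding H_def prod.case by (rule hits_cong) (use that(2) in auto)
    then show ?thesis using \<open>X \<in> M\<close> by (auto intro!: image_eqI)
  qed
  have "\<exists>j<m. \<exists>S. infinite S \<and> S \<subseteq> A j \<and>
      (\<forall>e k. infinite (\<Phi> e S) \<longrightarrow> (\<exists>x\<in>\<Phi> e S. min (c x) m \<noteq> k))"
    if cover: "(\<Union>j<m. A j) = UNIV" for m A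
  proof -
    \<comment> \<open>Discarding parts as long as possible makes the remaining ones meet every reservoir infinitely often.\<close>
    define good where "good l B X \<longleftrightarrow> (\<forall>i<l. \<exists>j<m. B i = A j) \<and> X \<in> M \<and> infinite X \<and> X \<subseteq> (\<Union>i<l. B i)"
      for l and B :: "nat \<Rightarrow> nat set" and X
    have "good m A UNIV" using cover \<open>UNIV \<in> M\<close> by (auto simp: good_def)
    define l where "l = (LEAST l. \<exists>B X. good l B X)"
    have "\<exists>B X. good l B X" unfolding l_def by (rule LeastI) (use \<open>good m A UNIV\<close> in blast)
    then obtain B X0 where B: "good l B X0" by blast
    have "l \<le> m" unfolding l_def by (rule Least_le) (use \<open>good m A UNIV\<close> in blast)
    have least: "\<not> good l' B' X'" if "l' < l" for l' B' X'
      using that not_less_Least unfolding l_def by blast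
    interpret reservoir_forcing \<Phi> M c l B X0
    proof
      show "\<exists>u. \<forall>S'. S' \<inter> {..<u} = S \<inter> {..<u} \<longrightarrow> x \<in> \<Phi> e S'" if "x \<in> \<Phi> e S" for x e S
        using use that .
      show "X - {..<u} \<in> M" if "X \<in> M" for X u using trunc that .
      show "\<exists>Y\<in>M. Y \<subseteq> X \<and> infinite Y \<and> starves (\<Phi> e) F n Y"
        if "X \<in> M" "finite F" "Y \<subseteq> X" "infinite Y" "starves (\<Phi> e) F n Y" for X F Y e n
        using starve that .
      show "\<exists>n N. hits \<Phi> l d F X n N \<and> (\<forall>x. n < x \<and> x \<le> N \<longrightarrow> c x = i)"
        if "X \<in> M" "\<forall>j<l. finite (F j)" "\<forall>n. \<exists>N. hits \<Phi> l d F X n N" for X F d i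
        using c[THEN bspec, OF hits_H[OF that(1,2)]] that(3) by blast
      show "X0 \<in> M" "infinite X0" "X0 \<subseteq> (\<Union>j<l. B j)" using B by (auto simp: good_def)
      show "infinite (X \<inter> B j)" if X: "X \<in> M" "X \<subseteq> X0" "infinite X" and "j < l" for X j
      proof
        assume "finite (X \<inter> B j)"
        then obtain u where u: "\<And>x. x \<in> X \<inter> B j \<Longrightarrow> x < u"
          using finite_nat_set_iff_bounded by auto
        \<comment> \<open>Past \<open>u\<close> the part \<open>B j\<close> is no longer needed to
          cover \<open>X\<close>. The last part takes over index \<open>j\<close>, leaving
          \<open>l - 1\<close> parts, against the minimality of \<open>l\<close>.\<close>
        define B' where "B' = B(j := B (l - 1))"
        have "x \<in> (\<Union>i<l - 1. B' i)" if x: "x \<in> X - {..<u}" for x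
        proof -
          obtain i where i: "i < l" "x \<in> B i" using x X(2) B unfolding good_def by blast
          have "i \<noteq> j" using u x i by force
          show ?thesis
          proof (cases "i = l - 1")
            case True
            then show ?thesis using i \<open>i \<noteq> j\<close> \<open>j < l\<close> by (intro UN_I[of j]) (auto simp: B'_def)
          next
            case False
            then show ?thesis using i \<open>i \<noteq> j\<close> by (intro UN_I[of i]) (auto simp: B'_def)
          qed
        qed
        moreover have "\<forall>i<l - 1. \<exists>j<m. B' i = A j" using B \<open>j < l\<close> by (auto simp: good_def B'_def)
        moreover have "infinite (X - {..<u})" using X(3) by (simp add: Diff_infinite_finite)
        ultimately have "good (l - 1) B' (X - {..<u})"
          unfolding good_def using trunc[OF X(1)] by blast
        then show False using least \<open>j < l\<close> by (metis diff_less less_nat_zero_code neq0_conv zero_less_one)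
      qed
    qed
    obtain i S where i: "i < l" and S: "infinite S" "S \<subseteq> B i" and inhom: "\<And>e. inhomogeneous e S"
      using inhomogeneous_solution by blast
    obtain j where j: "j < m" "B i = A j" using B i unfolding good_def by blast
    have "\<exists>x\<in>\<Phi> e S. min (c x) m \<noteq> k" if inf: "infinite (\<Phi> e S)" for e k
    proof -
      obtain x y where xy: "x \<in> \<Phi> e S" "y \<in> \<Phi> e S" "min (c x) l \<noteq> min (c y) l"
        using inhom[of e] inf unfolding inhomogeneous_def by blast
      \<comment> \<open>As \<open>l \<le> m\<close>, merging from \<open>m\<close> on identifies
        fewer colours than merging from \<open>l\<close> on.\<close>
      have "min (c x) m \<noteq> min (c y) m" using xy(3) \<open>l \<le> m\<close> by (auto simp: min_def split: if_splits)
      then show ?thesis using xy by metis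
    qed
    moreover have "S \<subseteq> A j" using S(2) j(2) by simp
    ultimately show ?thesis using S(1) j(1) by (intro exI[of _ j] exI[of _ S] conjI allI impI)
  qed
  then show ?thesis by (intro exI[of _ c] allI impI)
qed

section \<open>Cohesive sets as almost homogeneous sets\<close>

theorem theorem1p5:
  "\<exists>R :: nat \<Rightarrow> nat set.
     \<forall>(m :: nat) (A :: nat \<Rightarrow> nat set).
       (\<Union>j<m. A j) = UNIV \<and> disjoint_family_on A {..<m} \<and>
       (\<forall>j<m. arithmetical_in R (A j)) \<longrightarrow>
       (\<exists>j<m. \<exists>S. infinite S \<and> S \<subseteq> A j \<and>
          (\<forall>C. cohesive R C \<longrightarrow> \<not> computes S C))"
proof -
  \<comment> \<open>The index also carries a cutoff \<open>b\<close>, so that a tail of a computed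
    set is itself a value of \<open>\<Phi>\<close>.\<close>
  define \<Phi> where "\<Phi> e S = {x. \<exists>P b. from_nat e = (P :: program, b :: nat) \<and> b \<le> x \<and> tm_output P S x 1}"
    for e S
  have "\<exists>u. \<forall>S'. S' \<inter> {..<u} = S \<inter> {..<u} \<longrightarrow> x \<in> \<Phi> e S'" if "x \<in> \<Phi> e S" for x e S
  proof -
    obtain P b where Pb: "from_nat e = (P :: program, b :: nat)" "b \<le> x" "tm_output P S x 1"
      using \<open>x \<in> \<Phi> e S\<close> unfolding \<Phi>_def by blast
    obtain u where "\<forall>S'. S' \<inter> {..<u} = S \<inter> {..<u} \<longrightarrow> tm_output P S' x 1"
      using tm_output_finite_use[OF Pb(3)] by blast
    then show ?thesis using Pb(1,2) by (intro exI[of _ u]) (simp add: \<Phi>_def)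
  qed
  from exists_generic_coloring[OF this]
  obtain c :: "nat \<Rightarrow> nat" where c: "\<forall>m A. (\<Union>j<m. A j) = UNIV \<longrightarrow>
      (\<exists>j<m. \<exists>S. infinite S \<and> S \<subseteq> A j \<and>
        (\<forall>e k. infinite (\<Phi> e S) \<longrightarrow> (\<exists>x\<in>\<Phi> e S. min (c x) m \<noteq> k)))"
    by (rule exE)
  define R where "R i = {x. c x = i}" for i
  \<comment> \<open>Either some \<open>R i\<close> with \<open>i < m\<close> contains almost all of
    \<open>C\<close>, or almost all of \<open>C\<close> has colours from \<open>m\<close> on, which
    merge into \<open>m\<close>.\<close>
  have almost_homogeneous: "\<exists>k b. \<forall>x\<in>C. b \<le> x \<longrightarrow> min (c x) m = k" if "cohesive R C" for C m
  proof (cases "\<exists>i<m. finite (C \<inter> - R i)")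
    case True
    then obtain i where "i < m" and fin: "finite (C \<inter> - R i)" by blast
    obtain b where "\<And>x. x \<in> C \<inter> - R i \<Longrightarrow> x < b"
      using fin finite_nat_set_iff_bounded by auto
    then have "\<forall>x\<in>C. b \<le> x \<longrightarrow> min (c x) m = i" using \<open>i < m\<close> by (fastforce simp: R_def)
    then show ?thesis by blast
  next
    case False
    then have "finite (\<Union>i<m. C \<inter> R i)" using that unfolding cohesive_def by blast
    then obtain b where b: "\<forall>x\<in>(\<Union>i<m. C \<inter> R i). x < b"
      unfolding finite_nat_set_iff_bounded by blast
    have "\<forall>x\<in>C. b \<le> x \<longrightarrow> min (c x) m = m"
    proof (intro ballI impI)
      fix x assume x: "x \<in> C" "b \<le> x"
      have "\<not> c x < m"
      proof
        assume "c x < m"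
        then have "x \<in> (\<Union>i<m. C \<inter> R i)" using x(1) by (simp add: R_def)
        then have "x < b" using b by (rule bspec[rotated])
        then show False using x(2) by simp
      qed
      then show "min (c x) m = m" by simp
    qed
    then show ?thesis by blast
  qed
  have "\<exists>j<m. \<exists>S. infinite S \<and> S \<subseteq> A j \<and> (\<forall>C. cohesive R C \<longrightarrow> \<not> computes S C)"
    if cover: "(\<Union>j<m. A j) = UNIV" for m :: nat and A
  proof -
    obtain j S where j: "j < m" and S: "infinite S" "S \<subseteq> A j"
      and inhom: "\<And>e k. infinite (\<Phi> e S) \<Longrightarrow> \<exists>x\<in>\<Phi> e S. min (c x) m \<noteq> k"
      using c[THEN spec, THEN spec, THEN mp, OF cover] by blast
    have "\<not> computes S C" if C: "cohesive R C" for C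
    proof
      assume "computes S C"
      then obtain P where P: "\<And>x. tm_output P S x (if x \<in> C then 1 else 0)"
        unfolding computes_def by blast
      have C_eq: "tm_output P S x 1 \<longleftrightarrow> x \<in> C" for x
        using P[of x] tm_output_unique[of P S x 1 0] by (auto split: if_splits)
      obtain k b where kb: "\<And>x. x \<in> C \<Longrightarrow> b \<le> x \<Longrightarrow> min (c x) m = k"
        using almost_homogeneous[OF C] by blast
      \<comment> \<open>Beyond \<open>b\<close> the merged colour is constantly \<open>k\<close> on
        \<open>C\<close>, so this infinite value of \<open>\<Phi>\<close> contradicts
        \<open>inhom\<close>.\<close>
      have \<Phi>: "\<Phi> (to_nat (P, b)) S = C - {..<b}" by (auto simp: \<Phi>_def C_eq[unfolded One_nat_def])
      have "infinite (C - {..<b})" using C by (simp add: cohesive_def Diff_infinite_finite)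
      then show False using inhom[of "to_nat (P, b)" k] kb unfolding \<Phi> by auto
    qed
    then show ?thesis using j S by blast
  qed
  then show ?thesis by (intro exI[of _ R]) blast
qed

end
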